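(* For each non-trivial finite subgroup $G$ of $\mathrm{PSL}(2,\mathbb C)$, there exist an integer $n\ge5$ and an orbifold singularity of $\mathfrak{M}_{0,n}$ whose stabilizer is (isomorphic to) $G$.
   Context: $\widehat{\mathbb C}=\mathbb C\cup\{\infty\}$. $\mathfrak{M}_{0,n}$ is the set of isomorphism classes of compact Riemann surfaces of genus $0$ with $n$ unordered (distinct) marked points: $(C,\{p_1,\dots,p_n\})$ and $(C',\{p_1',\dots,p_n'\})$ are isomorphic if there is a biholomorphic map $f:C\to C'$ with $f(\{p_1,\dots,p_n\})=\{p_1',\dots,p_n'\}$. Let $K_n=\{\boldsymbol{\lambda}=(\lambda_1,\dots,\lambda_{n-3})\in\mathbb C^{n-3}\mid \lambda_i\ne 0,1,\ \lambda_i\ne\lambda_j\ \text{for all } i\neq j\}$. For $\boldsymbol\lambda\in K_n$ put $z_1^{\boldsymbol\lambda}=0$, $z_2^{\boldsymbol\lambda}=1$, $z_3^{\boldsymbol\lambda}=\infty$, $z_{i+3}^{\boldsymbol\lambda}=\lambda_i$ for $1\le i\le n-3$. For $\sigma\in S_n$ let $f_\sigma^{\boldsymbol\lambda}$ be the unique Möbius transformation with $f_\sigma^{\boldsymbol\lambda}(z^{\boldsymbol\lambda}_{\sigma^{-1}(1)})=0$, $f_\sigma^{\boldsymbol\lambda}(z^{\boldsymbol\lambda}_{\sigma^{-1}(2)})=1$, $f_\sigma^{\boldsymbol\lambda}(z^{\boldsymbol\lambda}_{\sigma^{-1}(3)})=\infty$. Define $g_\sigma:K_n\to K_n$ by $g_\sigma(\boldsymbol\lambda)=(f_\sigma^{\boldsymbol\lambda}(z^{\boldsymbol\lambda}_{\sigma^{-1}(4)}),\dots,f_\sigma^{\boldsymbol\lambda}(z^{\boldsymbol\lambda}_{\sigma^{-1}(n)}))$,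 and $G_n=\{g_\sigma\mid\sigma\in S_n\}$, a group under composition. $\mathfrak{M}_{0,n}$ is identified with $K_n/G_n$ via $\boldsymbol\lambda\mapsto$ the class of $(\widehat{\mathbb C},[\boldsymbol\lambda])$, where $[\boldsymbol\lambda]=\{0,1,\infty,\lambda_1,\dots,\lambda_{n-3}\}$. For $n\ge5$, the class of $[\boldsymbol\lambda]$ is called an orbifold singularity of $\mathfrak{M}_{0,n}$ if $G_{\boldsymbol\lambda}=\{g_\sigma\in G_n\mid g_\sigma(\boldsymbol\lambda)=\boldsymbol\lambda\}$ is non-trivial, and $G_{\boldsymbol\lambda}$ is its stabilizer. *)

theory Defs
  imports "HOL-Analysis.Analysis" "HOL-Algebra.Coset" "HOL-Combinatorics.Permutations"
begin

definition SL2C :: "(complex^2^2) monoid" where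
  "SL2C = \<lparr>carrier = {A. det A = 1}, mult = (**), one = mat 1\<rparr>"

definition PSL2C :: "(complex^2^2) set monoid" where
  "PSL2C = SL2C Mod {mat 1, - mat 1}"

(* A Riemann surface is a topological space X together with an atlas A of complex charts
   (U, phi).  The values of phi outside U are irrelevant.  Second countability is not
   required: for the compact surfaces used below it is automatic. *)

definition riemann_surface :: "'a topology \<Rightarrow> ('a set \<times> ('a \<Rightarrow> complex)) set \<Rightarrow> bool" where
  "riemann_surface X A \<longleftrightarrow>
     Hausdorff_space X \<and> connected_space X \<and>
     \<Union> (fst ` A) = topspace X \<and>
     (\<forall>(U, \<phi>)\<in>A. openin X U \<and> open (\<phi> ` U) \<and>
        homeomorphic_map (subtopology X U) (top_of_set (\<phi> ` U)) \<phi>) \<and>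
     (\<forall>(U, \<phi>)\<in>A. \<forall>(V, \<psi>)\<in>A. (\<psi> \<circ> inv_into U \<phi>) holomorphic_on \<phi> ` (U \<inter> V))"

definition holomorphic_map ::
  "'a topology \<Rightarrow> ('a set \<times> ('a \<Rightarrow> complex)) set \<Rightarrow>
   'b topology \<Rightarrow> ('b set \<times> ('b \<Rightarrow> complex)) set \<Rightarrow> ('a \<Rightarrow> 'b) \<Rightarrow> bool" where
  "holomorphic_map X A Y B f \<longleftrightarrow>
     continuous_map X Y f \<and>
     (\<forall>(U, \<phi>)\<in>A. \<forall>(V, \<psi>)\<in>B.
        (\<psi> \<circ> f \<circ> inv_into U \<phi>) holomorphic_on \<phi> ` (U \<inter> f -` V))"

definition biholomorphic_map ::
  "'a topology \<Rightarrow> ('a set \<times> ('a \<Rightarrow> complex)) set \<Rightarrow>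
   'b topology \<Rightarrow> ('b set \<times> ('b \<Rightarrow> complex)) set \<Rightarrow> ('a \<Rightarrow> 'b) \<Rightarrow> bool" where
  "biholomorphic_map X A Y B f \<longleftrightarrow>
     bij_betw f (topspace X) (topspace Y) \<and> holomorphic_map X A Y B f \<and>
     holomorphic_map Y B X A (inv_into (topspace X) f)"

definition genus_zero :: "'a topology \<Rightarrow> bool" where
  "genus_zero X \<longleftrightarrow> X homeomorphic_space top_of_set (sphere (0::real^3) 1)"

(* The Riemann sphere: Some z is the finite point z, None is the point at infinity. *)

type_synonym riemann_sphere = "complex option"

type_synonym 'a marked_surface =
  "'a topology \<times> ('a set \<times> ('a \<Rightarrow> complex)) set \<times> 'a set"

definition sphere_top :: "riemann_sphere topology" where
  "sphere_top = Alexandroff_compactification euclidean"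

definition sphere_atlas :: "(riemann_sphere set \<times> (riemann_sphere \<Rightarrow> complex)) set" where
  "sphere_atlas =
     {(- {None}, the),
      (- {Some 0}, \<lambda>p. case p of None \<Rightarrow> 0 | Some z \<Rightarrow> inverse z)}"

(* To speak of the set of all marked surfaces, the underlying point sets are taken inside
   the type of points of the sphere; a genus 0 surface has the cardinality of the continuum,
   so every one of them has an isomorphic copy there. *)

definition marked_surfaces :: "nat \<Rightarrow> riemann_sphere marked_surface set" where
  "marked_surfaces n =
     {(X, A, P). riemann_surface X A \<and> compact_space X \<and> genus_zero X \<and>
                 P \<subseteq> topspace X \<and> finite P \<and> card P = n}"

definition marked_iso :: "nat \<Rightarrow> (riemann_sphere marked_surface \<times> riemann_sphere marked_surface) set" where
  "marked_iso n =
     {((X, A, P), (Y, B, Q)).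
        (X, A, P) \<in> marked_surfaces n \<and> (Y, B, Q) \<in> marked_surfaces n \<and>
        (\<exists>f. biholomorphic_map X A Y B f \<and> f ` P = Q)}"

definition M0 :: "nat \<Rightarrow> riemann_sphere marked_surface set set" where
  "M0 n = marked_surfaces n // marked_iso n"

(* A tuple (lambda_1, ..., lambda_{n-3}) is a function that is undefined outside {1..n-3}. *)

definition Kn :: "nat \<Rightarrow> (nat \<Rightarrow> complex) set" where
  "Kn n = {l \<in> {1..n - 3} \<rightarrow>\<^sub>E - {0, 1}. inj_on l {1..n - 3}}"

definition zpt :: "(nat \<Rightarrow> complex) \<Rightarrow> nat \<Rightarrow> riemann_sphere" where
  "zpt l i = (if i = 1 then Some 0 else if i = 2 then Some 1
             else if i = 3 then None else Some (l (i - 3)))"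

definition marking :: "nat \<Rightarrow> (nat \<Rightarrow> complex) \<Rightarrow> riemann_sphere set" where
  "marking n l = {Some 0, Some 1, None} \<union> (\<lambda>i. Some (l i)) ` {1..n - 3}"

definition moduli_class :: "nat \<Rightarrow> (nat \<Rightarrow> complex) \<Rightarrow> riemann_sphere marked_surface set" where
  "moduli_class n l = marked_iso n `` {(sphere_top, sphere_atlas, marking n l)}"

definition moebius_sphere ::
  "complex \<Rightarrow> complex \<Rightarrow> complex \<Rightarrow> complex \<Rightarrow> riemann_sphere \<Rightarrow> riemann_sphere" where
  "moebius_sphere a b c d p =
     (case p of
        None \<Rightarrow> if c = 0 then None else Some (a / c)
      | Some z \<Rightarrow> if c * z + d = 0 then None else Some (moebius a b c d z))"

definition moebius_transformation :: "(riemann_sphere \<Rightarrow> riemann_sphere) \<Rightarrow> bool" where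
  "moebius_transformation f \<longleftrightarrow>
     (\<exists>a b c d. a * d - b * c \<noteq> 0 \<and> f = moebius_sphere a b c d)"

definition f_perm :: "(nat \<Rightarrow> nat) \<Rightarrow> (nat \<Rightarrow> complex) \<Rightarrow> riemann_sphere \<Rightarrow> riemann_sphere" where
  "f_perm \<sigma> l = (THE f. moebius_transformation f \<and>
     f (zpt l (inv_into UNIV \<sigma> 1)) = Some 0 \<and> f (zpt l (inv_into UNIV \<sigma> 2)) = Some 1 \<and> f (zpt l (inv_into UNIV \<sigma> 3)) = None)"

(* For l in Kn n, the image points below are all finite, so "the" just removes Some. *)

definition g_perm :: "nat \<Rightarrow> (nat \<Rightarrow> nat) \<Rightarrow> (nat \<Rightarrow> complex) \<Rightarrow> (nat \<Rightarrow> complex)" where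
  "g_perm n \<sigma> = (\<lambda>l\<in>Kn n. \<lambda>i\<in>{1..n - 3}. the (f_perm \<sigma> l (zpt l (inv_into UNIV \<sigma> (i + 3)))))"

definition Gn :: "nat \<Rightarrow> ((nat \<Rightarrow> complex) \<Rightarrow> (nat \<Rightarrow> complex)) monoid" where
  "Gn n = \<lparr>carrier = {g_perm n \<sigma> | \<sigma>. \<sigma> permutes {1..n}},
           mult = compose (Kn n), one = \<lambda>l\<in>Kn n. l\<rparr>"

definition stab :: "nat \<Rightarrow> (nat \<Rightarrow> complex) \<Rightarrow> ((nat \<Rightarrow> complex) \<Rightarrow> (nat \<Rightarrow> complex)) monoid" where
  "stab n l = (Gn n)\<lparr>carrier := {g \<in> carrier (Gn n). g l = l}\<rparr>"

definition orbifold_singularity :: "nat \<Rightarrow> riemann_sphere marked_surface set \<Rightarrow> bool" where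
  "orbifold_singularity n x \<longleftrightarrow>
     n \<ge> 5 \<and> x \<in> M0 n \<and>
     (\<exists>l\<in>Kn n. x = moduli_class n l \<and> carrier (stab n l) \<noteq> {\<one>\<^bsub>Gn n\<^esub>})"

end

theory Submission
  imports Defs
begin

text \<open>
  For \<open>n \<ge> 5\<close>, the stabilizer of \<open>l\<close> in \<open>Gn n\<close> is nothing but the group of Moebius
  transformations that map the marked set \<open>{0, 1, \<infinity>, l\<^sub>1, \<dots>}\<close> onto itself
  (\<open>moebius_stabilizer_iso_stab\<close>). A symmetry of the marked set permutes the
  marked points, and the corresponding permutation fixes the parameter \<open>l\<close>; since a Moebius
  transformation is determined by three values, the symmetry is determined by the permutation.
  The point that needs \<open>n \<ge> 5\<close> is that the permutation in turn is determined by its action on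
  the parameters (\<open>g_perm_trivial_imp_id\<close>).

  Since \<open>PSL2C\<close> acts faithfully by Moebius transformations, it remains to find, for a finite
  group \<open>S\<close> of Moebius transformations, a finite set \<open>P\<close> of points whose symmetries are exactly
  the elements of \<open>S\<close> (\<open>exists_set_with_stabilizer\<close>). Such a set is the union of a large
  invariant set with one generic orbit: the large part admits only finitely many candidates for
  further symmetries, and a generic orbit excludes each of them. Moving three points of \<open>P\<close> to 0, 1 and
  infinity conjugates the group of symmetries and turns \<open>P\<close> into the marking of some \<open>l\<close> in \<open>Kn n\<close>.

  For the class of this marking to be a point of \<open>M0 n\<close>, the marked sphere must be a compact
  Riemann surface of genus zero in the sense of the definitions, which is the purpose of the
  first section.
\<close>

section \<open>The sphere as a compact Riemann surface of genus zero\<close>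

lemma continuous_map_Alexandroff_map_option:
  assumes "homeomorphic_maps X Y h k"
  shows "continuous_map (Alexandroff_compactification X) (Alexandroff_compactification Y)
           (map_option h)"
proof -
  have h: "continuous_map X Y h" and k: "continuous_map Y X k"
    and hk: "\<And>x. x \<in> topspace X \<Longrightarrow> k (h x) = x" "\<And>y. y \<in> topspace Y \<Longrightarrow> h (k y) = y"
    using assms by (auto simp: homeomorphic_maps_def)
  have hX: "h x \<in> topspace Y" if "x \<in> topspace X" for x
    using h that by (auto simp: continuous_map_def)
  have kY: "k x \<in> topspace X" if "x \<in> topspace Y" for x
    using k that by (auto simp: continuous_map_def)
  show ?thesis
    unfolding continuous_map_def
  proof (intro conjI allI impI)
    show "map_option h \<in> topspace (Alexandroff_compactification X) \<rightarrow>
            topspace (Alexandroff_compactification Y)"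
      using hX by auto
  next
    fix U assume "openin (Alexandroff_compactification Y) U"
    then consider V where "openin Y V" "U = Some ` V"
      | C where "compactin Y C" "closedin Y C" "U = insert None (Some ` (topspace Y - C))"
      by (auto simp: openin_Alexandroff_compactification)
    then show "openin (Alexandroff_compactification X)
        {x \<in> topspace (Alexandroff_compactification X). map_option h x \<in> U}"
    proof cases
      case 1
      have "{x \<in> topspace (Alexandroff_compactification X). map_option h x \<in> U}
          = Some ` {x \<in> topspace X. h x \<in> V}"
        using 1 by auto
      then show ?thesis
        using openin_continuous_map_preimage[OF h \<open>openin Y V\<close>] by simp
    next
      case 2
      have kC: "k ` C = {x \<in> topspace X. h x \<in> C}"
        using closedin_subset[OF 2(2)] hk hX kY by (force simp: image_iff)
      have "{x \<in> topspace (Alexandroff_compactification X). map_option h x \<in> U}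
          = insert None (Some ` (topspace X - k ` C))"
        unfolding kC using 2 hX by auto
      moreover have "compactin X (k ` C)"
        using image_compactin[OF 2(1) k] .
      moreover have "closedin X (k ` C)"
        unfolding kC using closedin_continuous_map_preimage[OF h 2(2)] .
      ultimately show ?thesis
        by (auto simp: openin_Alexandroff_compactification)
    qed
  qed
qed

text \<open>
  A homeomorphism and its inverse both extend to the compactifications by fixing the
  added point. This moves the model of the sphere between the plane and a punctured round sphere.
\<close>

lemma homeomorphic_space_Alexandroff_compactification:
  assumes "X homeomorphic_space Y"
  shows "Alexandroff_compactification X homeomorphic_space Alexandroff_compactification Y"
proof -
  obtain h k where hk: "homeomorphic_maps X Y h k"
    using assms by (auto simp: homeomorphic_space_def)
  have kh: "homeomorphic_maps Y X k h"
    using hk homeomorphic_maps_sym by blast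
  have "homeomorphic_maps (Alexandroff_compactification X) (Alexandroff_compactification Y)
          (map_option h) (map_option k)"
    using continuous_map_Alexandroff_map_option[OF hk] continuous_map_Alexandroff_map_option[OF kh] hk
    by (auto simp: homeomorphic_maps_def)
  then show ?thesis
    by (rule homeomorphic_maps_imp_homeomorphic_space)
qed

lemma topspace_sphere_top [simp]: "topspace sphere_top = UNIV"
  by (auto simp: sphere_top_def UNIV_option_conv)

lemma compact_space_sphere_top: "compact_space sphere_top"
  by (simp add: sphere_top_def)

lemma Hausdorff_space_sphere_top: "Hausdorff_space sphere_top"
  by (simp add: sphere_top_def Hausdorff_space_Alexandroff_compactification
      Hausdorff_space_euclidean locally_compact_space_euclidean)

text \<open>
  Stereographic projection identifies the plane with the unit sphere minus one point, and
  the one-point compactification of a punctured compact Hausdorff space restores that space.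
\<close>

lemma genus_zero_sphere_top: "genus_zero sphere_top"
proof -
  let ?S = "sphere (0::real^3) 1"
  let ?H = "{x::real^3. axis 1 1 \<bullet> x = 0}"
  have b: "axis 1 1 \<in> ?S"
    by (simp add: norm_axis_1)
  have "?S - {axis 1 1} homeomorphic ?H"
    by (intro homeomorphic_punctured_sphere_hyperplane) (use b in auto)
  moreover have "?H homeomorphic (UNIV :: complex set)"
  proof (rule homeomorphic_subspaces)
    show "dim ?H = dim (UNIV :: complex set)"
      by (subst dim_hyperplane) auto
  qed (auto simp: subspace_hyperplane)
  ultimately have "(UNIV :: complex set) homeomorphic ?S - {axis 1 1}"
    by (meson homeomorphic_sym homeomorphic_trans)
  then obtain f g where "homeomorphism (UNIV :: complex set) (?S - {axis 1 1}) f g"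
    by (auto simp: homeomorphic_def)
  then have "homeomorphic_maps (euclidean :: complex topology) (top_of_set (?S - {axis 1 1})) f g"
    by (auto simp: homeomorphic_maps_def homeomorphism_def continuous_map_in_subtopology)
  then have "(euclidean :: complex topology) homeomorphic_space top_of_set (?S - {axis 1 1})"
    by (rule homeomorphic_maps_imp_homeomorphic_space)
  then have "sphere_top homeomorphic_space
      Alexandroff_compactification (top_of_set (?S - {axis 1 1}))"
    unfolding sphere_top_def by (rule homeomorphic_space_Alexandroff_compactification)
  also have "Alexandroff_compactification (top_of_set (?S - {axis 1 1}))
      homeomorphic_space top_of_set ?S"
  proof -
    have "Alexandroff_compactification (subtopology (top_of_set ?S) (topspace (top_of_set ?S) - {axis 1 1}))
      homeomorphic_space top_of_set ?S"
    proof (rule Alexandroff_compactification_unique)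
      show "kc_space (top_of_set ?S)"
        by (simp add: Hausdorff_imp_kc_space Hausdorff_space_subtopology Hausdorff_space_euclidean)
      show "compact_space (top_of_set ?S)"
        by (simp add: compact_space_subtopology)
    qed (use b in auto)
    moreover have "?S \<inter> (?S - {axis 1 1}) = ?S - {axis 1 1}" by blast
    ultimately show ?thesis
      by (simp add: subtopology_subtopology)
  qed
  finally show ?thesis
    by (simp add: genus_zero_def)
qed

lemma connected_space_sphere_top: "connected_space sphere_top"
proof -
  have "connected_space (top_of_set (sphere (0::real^3) 1))"
    by (simp add: connected_space_subtopology connected_sphere)
  then show ?thesis
    using genus_zero_sphere_top homeomorphic_connected_space unfolding genus_zero_def by blast
qed

text \<open>
  The chart at infinity is the chart \<^term>\<open>the\<close> preceded by this involution of the sphere, so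
  that the properties of the second chart follow from those of the first.
\<close>

definition inversion :: "riemann_sphere \<Rightarrow> riemann_sphere" where
  "inversion p = (case p of None \<Rightarrow> Some 0 | Some z \<Rightarrow> if z = 0 then None else Some (inverse z))"

lemma inversion_inversion [simp]: "inversion (inversion p) = p"
  by (cases p) (auto simp: inversion_def)

text \<open>
  Describing open sets by their finite part allows the preimage under the inversion to be
  treated as a subset of the plane.
\<close>

lemma openin_sphere_top:
  "openin sphere_top U \<longleftrightarrow> open (Some -` U) \<and> (None \<in> U \<longrightarrow> compact (- (Some -` U)))"
proof -
  have 1: "(\<exists>V. open V \<and> U = Some ` V) \<longleftrightarrow> open (Some -` U) \<and> None \<notin> U" 
  proof
    assume "open (Some -` U) \<and> None \<notin> U"
    moreover from this have "U = Some ` (Some -` U)"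
      by (auto simp: image_iff) (metis not_None_eq)
    ultimately show "\<exists>V. open V \<and> U = Some ` V" by blast
  qed (auto simp: inj_vimage_image_eq)
  have 2: "(\<exists>C. compact C \<and> closed C \<and> U = insert None (Some ` (- C))) \<longleftrightarrow>
      open (Some -` U) \<and> None \<in> U \<and> compact (- (Some -` U))" (is "?L \<longleftrightarrow> ?R")
  proof
    assume ?R
    moreover from this have "U = insert None (Some ` (- (- (Some -` U))))"
      by (auto simp: image_iff)
    ultimately show ?L using open_closed by blast
  next
    assume ?L
    then obtain C where C: "compact C" "closed C" "U = insert None (Some ` (- C))" by blast
    then have "Some -` U = - C" by auto
    with C show ?R by auto
  qed
  show ?thesis
    using 1 2 unfolding sphere_top_def openin_Alexandroff_compactification
    by (auto simp: Compl_eq_Diff_UNIV)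
qed

text \<open>
  Away from 0 and infinity this is continuity of \<open>inverse\<close>. The two special points are
  exchanged by the correspondence between large and small norms: if the finite part of \<open>U\<close>
  contains everything outside a disc of radius \<open>B\<close>, its preimage contains the disc of
  radius \<open>1 / B\<close>, and a disc of radius \<open>e\<close> inside \<open>U\<close> bounds the complement of the preimage
  by \<open>1 / e\<close>.
\<close>

lemma continuous_map_inversion: "continuous_map sphere_top sphere_top inversion"
  unfolding continuous_map_def
proof (intro conjI allI impI)
  fix U assume U: "openin sphere_top U"
  let ?V = "{x \<in> topspace sphere_top. inversion x \<in> U}"
  let ?W = "Some -` U" 
  have W: "open ?W" using U by (simp add: openin_sphere_top)
  have V: "Some -` ?V - {0} = inverse -` ?W - {0}"
    by (auto simp: inversion_def)
  have c: "continuous_on (- {0}) (inverse :: complex \<Rightarrow> complex)"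
    by (intro continuous_intros) auto
  have o: "open (inverse -` ?W - {0})"
    using continuous_open_preimage[OF c _ W] by (simp add: Diff_eq Int_commute open_delete open_Compl)
  show "openin sphere_top ?V"
    unfolding openin_sphere_top
  proof
    show "open (Some -` ?V)"
    proof (cases "None \<in> U")
      case False
      then have "Some -` ?V = inverse -` ?W - {0}"
        using V by (auto simp: inversion_def)
      then show ?thesis using o by simp
    next
      case True
      then have "bounded (- ?W)"
        using U by (simp add: openin_sphere_top compact_imp_bounded)
      then obtain B where B: "B > 0" "\<And>z. z \<notin> ?W \<Longrightarrow> norm z \<le> B"
        unfolding bounded_pos by auto
      have "ball 0 (inverse B) \<subseteq> Some -` ?V"
      proof
        fix z :: complex assume z: "z \<in> ball 0 (inverse B)"
        show "z \<in> Some -` ?V"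
        proof (cases "z = 0")
          case False
          then have "norm (inverse z) > B"
            using z B by (simp add: norm_inverse) (metis inverse_inverse_eq less_imp_inverse_less zero_less_norm_iff)
          then have "inverse z \<in> ?W" using B(2) by fastforce
          then show ?thesis using False by (auto simp: inversion_def)
        qed (use True in \<open>auto simp: inversion_def\<close>)
      qed
      then have "Some -` ?V = (inverse -` ?W - {0}) \<union> ball 0 (inverse B)"
        unfolding V[symmetric] using B(1) centre_in_ball[of "0::complex" "inverse B"]
        by (auto simp only: inverse_positive_iff_positive)
      then show ?thesis using open_Un[OF o open_ball] by simp
    qed
    show "None \<in> ?V \<longrightarrow> compact (- (Some -` ?V))"
    proof
      assume "None \<in> ?V"
      then have "0 \<in> ?W" by (simp add: inversion_def)
      then obtain e where e: "e > 0" "ball 0 e \<subseteq> ?W"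
        using W open_contains_ball by blast
      have "norm z \<le> inverse e" if "z \<in> - (Some -` ?V)" for z
      proof (cases "z = 0")
        case False
        then have "inverse z \<notin> ?W" using that by (auto simp: inversion_def)
        then have "norm (inverse z) \<ge> e" using e by force
        then show ?thesis using False e
          by (simp add: norm_inverse) (metis inverse_inverse_eq le_imp_inverse_le)
      qed (use e in auto)
      then have "bounded (- (Some -` ?V))" by (auto simp: bounded_iff)
      moreover have "closed (- (Some -` ?V))"
        using \<open>open (Some -` ?V)\<close> by (simp add: open_closed)
      ultimately show "compact (- (Some -` ?V))" by (simp add: compact_eq_bounded_closed)
    qed
  qed
qed auto

lemma homeomorphic_map_inversion: "homeomorphic_map sphere_top sphere_top inversion"
  by (simp add: homeomorphic_map_involution continuous_map_inversion)

lemma the_image_Compl_None: "the ` (- {None}) = (UNIV :: 'a set)"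
  by (force simp: image_iff)

lemma homeomorphic_map_the:
  "homeomorphic_map (subtopology sphere_top (- {None})) euclidean the"
proof -
  have "homeomorphic_map euclidean (subtopology sphere_top (range Some)) Some"
    using embedding_map_Some[of euclidean] by (simp add: embedding_map_def sphere_top_def)
  moreover have "range Some = - {None :: riemann_sphere}"
    by (auto simp: image_iff)
  ultimately have "homeomorphic_map euclidean (subtopology sphere_top (- {None})) Some" by simp
  then obtain g where "homeomorphic_maps euclidean (subtopology sphere_top (- {None})) Some g"
    by (auto simp: homeomorphic_map_maps)
  then have "homeomorphic_map (subtopology sphere_top (- {None})) euclidean g"
    and g: "\<And>z. g (Some z) = z"
    by (auto simp: homeomorphic_maps_map)
  then show ?thesis
    by (elim homeomorphic_map_eq) auto
qed

lemma homeomorphic_map_chart_infinity: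
  "homeomorphic_map (subtopology sphere_top (- {Some 0})) euclidean
     (\<lambda>p. case p of None \<Rightarrow> 0 | Some z \<Rightarrow> inverse z)"
proof -
  have "homeomorphic_map (subtopology sphere_top (- {Some 0})) (subtopology sphere_top (- {None})) inversion"
    by (rule homeomorphic_map_subtopologies_alt[OF homeomorphic_map_inversion])
      (auto simp: inversion_def split: option.splits)
  then have "homeomorphic_map (subtopology sphere_top (- {Some 0})) euclidean (the \<circ> inversion)"
    using homeomorphic_map_compose homeomorphic_map_the by blast
  then show ?thesis
    by (rule homeomorphic_map_eq) (auto simp: inversion_def split: option.splits)
qed

lemma chart_infinity_image:
  "(\<lambda>p. case p of None \<Rightarrow> 0 | Some z \<Rightarrow> inverse z) ` (- {Some 0}) = (UNIV :: complex set)"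
  using homeomorphic_imp_surjective_map[OF homeomorphic_map_chart_infinity] by simp

text \<open>
  Both transition maps between the two charts are \<open>inverse\<close> on the punctured plane.
\<close>

lemma riemann_surface_sphere: "riemann_surface sphere_top sphere_atlas"
proof -
  let ?c0 = "the :: riemann_sphere \<Rightarrow> complex"
  let ?c1 = "\<lambda>p::riemann_sphere. case p of None \<Rightarrow> 0 | Some z \<Rightarrow> inverse z"
  have inj0: "inj_on ?c0 (- {None})" and inj1: "inj_on ?c1 (- {Some 0})"
    using homeomorphic_imp_injective_map[OF homeomorphic_map_the]
      homeomorphic_imp_injective_map[OF homeomorphic_map_chart_infinity] by simp_all
  have i0: "inv_into (- {None}) ?c0 z = Some z" for z
    by (rule inv_into_f_eq[OF inj0]) auto
  have i1: "inv_into (- {Some 0}) ?c1 z = (if z = 0 then None else Some (inverse z))" for z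
    by (rule inv_into_f_eq[OF inj1]) auto
  have I: "- {None} \<inter> - {Some 0} = Some ` (- {0::complex})"
  proof (rule Set.set_eqI)
    show "p \<in> - {None} \<inter> - {Some 0} \<longleftrightarrow> p \<in> Some ` (- {0::complex})" for p
      by (cases p) auto
  qed
  have inv: "inverse holomorphic_on - {0::complex}"
    by (intro holomorphic_intros) auto
  have img0: "?c0 ` Some ` (- {0}) = - {0}"
    by (simp add: image_image)
  have "z \<in> inverse ` (- {0})" if "z \<noteq> 0" for z :: complex
    using that by (intro image_eqI[of _ _ "inverse z"]) auto
  then have img1: "?c1 ` Some ` (- {0}) = - {0}"
    by (auto simp: image_image)
  have "(?c0 \<circ> inv_into (- {None}) ?c0) holomorphic_on UNIV"
    by (simp add: i0 o_def)
  moreover have "(?c1 \<circ> inv_into (- {Some 0}) ?c1) holomorphic_on UNIV"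
    by (rule holomorphic_transform[OF holomorphic_on_ident]) (auto simp: i1)
  moreover have "(?c1 \<circ> inv_into (- {None}) ?c0) holomorphic_on ?c0 ` (- {None} \<inter> - {Some 0})"
    unfolding I img0 by (rule holomorphic_transform[OF inv]) (auto simp: i0)
  moreover have "(?c0 \<circ> inv_into (- {Some 0}) ?c1) holomorphic_on ?c1 ` (- {Some 0} \<inter> - {None})"
    unfolding Int_commute[of "- {Some 0}"] I img1
    by (rule holomorphic_transform[OF inv]) (auto simp: i1)
  moreover have "openin sphere_top (- {p})" for p
    using Hausdorff_imp_t1_space[OF Hausdorff_space_sphere_top]
    by (metis t1_space_openin_delete_alt openin_topspace topspace_sphere_top Compl_eq_Diff_UNIV)
  ultimately show ?thesis
    unfolding riemann_surface_def sphere_atlas_def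
    using Hausdorff_space_sphere_top connected_space_sphere_top
      homeomorphic_map_the homeomorphic_map_chart_infinity
    by (auto simp: the_image_Compl_None chart_infinity_image)
qed

lemma marked_sphere:
  assumes "finite P"
  shows "(sphere_top, sphere_atlas, P) \<in> marked_surfaces (card P)"
  using assms riemann_surface_sphere compact_space_sphere_top genus_zero_sphere_top
  by (simp add: marked_surfaces_def)

section \<open>Moebius transformations of the sphere\<close>

text \<open>
  The point of the sphere with homogeneous coordinates \<open>u : v\<close>. In these coordinates a
  Moebius transformation is linear, and the case distinctions around infinity disappear.
  The pair \<open>(0, 0)\<close> also yields \<^term>\<open>None\<close>, hence the side conditions below.
\<close>

definition hpt :: "complex \<Rightarrow> complex \<Rightarrow> riemann_sphere" where
  "hpt u v = (if v = 0 then None else Some (u / v))"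

lemma hpt_cases:
  obtains u v where "p = hpt u v" "u \<noteq> 0 \<or> v \<noteq> 0"
proof (cases p)
  case None
  then show ?thesis using that[of 1 0] by (simp add: hpt_def)
next
  case (Some z)
  then show ?thesis using that[of z 1] by (simp add: hpt_def)
qed

lemma hpt_eq_iff:
  assumes "u \<noteq> 0 \<or> v \<noteq> 0" "u' \<noteq> 0 \<or> v' \<noteq> 0"
  shows "hpt u v = hpt u' v' \<longleftrightarrow> u * v' - v * u' = 0"
  using assms by (auto simp: hpt_def field_simps)

lemma moebius_sphere_hpt:
  assumes "u \<noteq> 0 \<or> v \<noteq> 0"
  shows "moebius_sphere a b c d (hpt u v) = hpt (a * u + b * v) (c * u + d * v)"
proof (cases "v = 0")
  case False
  have 1: "c * (u / v) + d = (c * u + d * v) / v" and 2: "a * (u / v) + b = (a * u + b * v) / v"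
    using False by (simp_all add: field_simps)
  show ?thesis
    unfolding hpt_def moebius_sphere_def moebius_def
    using False by (simp add: 1 2 del: times_divide_eq_right)
qed (use assms in \<open>auto simp: hpt_def moebius_sphere_def\<close>)

lemma linear_2_nonzero:
  fixes a b c d u v :: complex
  assumes "a * d - b * c \<noteq> 0" "u \<noteq> 0 \<or> v \<noteq> 0"
  shows "a * u + b * v \<noteq> 0 \<or> c * u + d * v \<noteq> 0"
proof (rule ccontr)
  assume "\<not> ?thesis"
  then have 0: "a * u + b * v = 0" "c * u + d * v = 0" by auto
  have "(a * d - b * c) * u = d * (a * u + b * v) - b * (c * u + d * v)"
    "(a * d - b * c) * v = a * (c * u + d * v) - c * (a * u + b * v)"
    by (simp_all add: algebra_simps)
  with 0 assms show False by simp
qed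

lemma moebius_sphere_comp:
  assumes "a' * d' - b' * c' \<noteq> 0"
  shows "moebius_sphere a b c d \<circ> moebius_sphere a' b' c' d' =
    moebius_sphere (a * a' + b * c') (a * b' + b * d') (c * a' + d * c') (c * b' + d * d')"
proof
  fix p
  obtain u v where p: "p = hpt u v" "u \<noteq> 0 \<or> v \<noteq> 0" by (rule hpt_cases)
  show "(moebius_sphere a b c d \<circ> moebius_sphere a' b' c' d') p = 
    moebius_sphere (a * a' + b * c') (a * b' + b * d') (c * a' + d * c') (c * b' + d * d') p"
    using linear_2_nonzero[OF assms p(2)] p
    by (simp add: moebius_sphere_hpt) (simp add: algebra_simps)
qed

lemma moebius_sphere_scalar: "k \<noteq> 0 \<Longrightarrow> moebius_sphere k 0 0 k = id"
  by (auto simp: fun_eq_iff moebius_sphere_def moebius_def split: option.splits)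

lemma moebius_transformation_id: "moebius_transformation id"
  unfolding moebius_transformation_def
  by (intro exI[of _ 1] exI[of _ 0]) (auto simp: moebius_sphere_scalar)

lemma moebius_transformation_comp:
  assumes "moebius_transformation f" "moebius_transformation g"
  shows "moebius_transformation (f \<circ> g)"
proof -
  obtain a b c d a' b' c' d' where *: "a * d - b * c \<noteq> 0" "f = moebius_sphere a b c d"
    "a' * d' - b' * c' \<noteq> 0" "g = moebius_sphere a' b' c' d'"
    using assms unfolding moebius_transformation_def by metis
  have "(a * a' + b * c') * (c * b' + d * d') - (a * b' + b * d') * (c * a' + d * c')
      = (a * d - b * c) * (a' * d' - b' * c')"
    by (simp add: algebra_simps)
  then show ?thesis
    unfolding moebius_transformation_def *(2,4) moebius_sphere_comp[OF *(3)]
    using * by (metis mult_eq_0_iff)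
qed

lemma moebius_transformation_inverse:
  assumes "moebius_transformation f"
  obtains g where "moebius_transformation g" "f \<circ> g = id" "g \<circ> f = id"
proof -
  obtain a b c d where *: "a * d - b * c \<noteq> 0" "f = moebius_sphere a b c d"
    using assms unfolding moebius_transformation_def by metis
  let ?g = "moebius_sphere d (- b) (- c) a"
  have det: "d * a - (- b) * (- c) \<noteq> 0" using * by (simp add: algebra_simps)
  show thesis
  proof (rule that)
    show "moebius_transformation ?g"
      using det unfolding moebius_transformation_def by blast
    show "f \<circ> ?g = id"
      unfolding *(2) moebius_sphere_comp[OF det]
      using moebius_sphere_scalar[OF *(1)] by (simp add: algebra_simps)
    show "?g \<circ> f = id"
      unfolding *(2) moebius_sphere_comp[OF *(1)]
      using moebius_sphere_scalar[OF *(1)] by (simp add: algebra_simps)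
  qed
qed

lemma moebius_transformation_bij: "moebius_transformation f \<Longrightarrow> bij f"
  by (metis moebius_transformation_inverse o_bij)

lemma moebius_transformation_inj_iff:
  "moebius_transformation f \<Longrightarrow> f p = f q \<longleftrightarrow> p = q"
  using moebius_transformation_bij bij_is_inj inj_eq by metis

text \<open>
  In homogeneous coordinates \<open>u : v\<close>, the two linear forms \<open>u * p2 - v * p1\<close> and
  \<open>u * r2 - v * r1\<close> vanish exactly at \<open>p\<close> and at \<open>r\<close>, so their quotient sends \<open>p\<close> to 0 and
  \<open>r\<close> to infinity. The factors \<open>k\<close> and \<open>l\<close> are chosen so that \<open>q\<close> goes to 1.
\<close>

lemma moebius_transformation_to_0_1_infinity:
  assumes "p \<noteq> q" "q \<noteq> r" "p \<noteq> r"
  obtains f where "moebius_transformation f" "f p = Some 0" "f q = Some 1" "f r = None"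
proof -
  obtain p1 p2 q1 q2 r1 r2 where *: "p = hpt p1 p2" "p1 \<noteq> 0 \<or> p2 \<noteq> 0" "q = hpt q1 q2" "q1 \<noteq> 0 \<or> q2 \<noteq> 0"
    "r = hpt r1 r2" "r1 \<noteq> 0 \<or> r2 \<noteq> 0"
    using hpt_cases by metis
  let ?k = "q1 * r2 - q2 * r1" and ?l = "q1 * p2 - q2 * p1"
  have n: "?k \<noteq> 0" "?l \<noteq> 0" "p1 * r2 - p2 * r1 \<noteq> 0"
    using assms * by (metis hpt_eq_iff)+
  let ?f = "moebius_sphere (?k * p2) (- ?k * p1) (?l * r2) (- ?l * r1)"
  have "(?k * p2) * (- ?l * r1) - (- ?k * p1) * (?l * r2) = ?k * ?l * (p1 * r2 - p2 * r1)"
    by (simp add: algebra_simps)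
  then have f: "moebius_transformation ?f"
    using n unfolding moebius_transformation_def by (metis mult_eq_0_iff)
  have val: "?f (hpt u v) = hpt (?k * (u * p2 - v * p1)) (?l * (u * r2 - v * r1))"
    if "u \<noteq> 0 \<or> v \<noteq> 0" for u v
    unfolding moebius_sphere_hpt[OF that] by (simp add: algebra_simps)
  show thesis
  proof (rule that[OF f])
    show "?f p = Some 0" "?f q = Some 1" "?f r = None"
      unfolding * val[OF *(2)] val[OF *(4)] val[OF *(6)]
      using n by (simp_all add: hpt_def mult.commute)
  qed
qed

lemma moebius_transformation_fixing_0_1_infinity:
  assumes "moebius_transformation f" "f (Some 0) = Some 0" "f (Some 1) = Some 1" "f None = None"
  shows "f = id"
proof -
  obtain a b c d where *: "a * d - b * c \<noteq> 0" "f = moebius_sphere a b c d"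
    using assms unfolding moebius_transformation_def by metis
  have "c = 0" "b = 0" "a = d" "d \<noteq> 0"
    using assms(2-4) * by (auto simp: moebius_sphere_def moebius_def split: if_splits)
  then show ?thesis
    using * moebius_sphere_scalar by simp
qed

text \<open>
  Conjugating
  \<open>g\<inverse> \<circ> f\<close> by a map that sends the three points to 0, 1 and infinity yields a
  transformation that fixes 0, 1 and infinity, and such a transformation is the identity.
\<close>

lemma moebius_transformation_eqI:
  assumes "moebius_transformation f" "moebius_transformation g"
    and "p \<noteq> q" "q \<noteq> r" "p \<noteq> r" and "f p = g p" "f q = g q" "f r = g r"
  shows "f = g"
proof -
  obtain T where T: "moebius_transformation T" "T p = Some 0" "T q = Some 1" "T r = None"
    using moebius_transformation_to_0_1_infinity assms(3-5) by metis
  obtain S where S: "moebius_transformation S" "T \<circ> S = id" "S \<circ> T = id"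
    using moebius_transformation_inverse[OF T(1)] by metis
  obtain h where h: "moebius_transformation h" "g \<circ> h = id" "h \<circ> g = id"
    using moebius_transformation_inverse[OF assms(2)] by metis
  have ST: "S (Some 0) = p" "S (Some 1) = q" "S None = r"
    using S(3) T(2-4) by (metis comp_apply id_apply)+
  have hg: "h (g x) = x" for x
    using h(3) by (metis comp_apply id_apply)
  have "T \<circ> (h \<circ> f) \<circ> S = id"
    by (intro moebius_transformation_fixing_0_1_infinity moebius_transformation_comp S T h assms)
      (simp_all add: ST assms hg T)
  then have "g \<circ> (S \<circ> (T \<circ> (h \<circ> f) \<circ> S) \<circ> T) = g \<circ> (S \<circ> T)" by simp
  then have "g \<circ> ((S \<circ> T) \<circ> (h \<circ> f) \<circ> (S \<circ> T)) = g \<circ> (S \<circ> T)" by (simp add: o_assoc)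
  then show ?thesis using S(3) h(2) by (simp add: o_assoc)
qed

lemma finite_moebius_coincidence:
  assumes "moebius_transformation f" "moebius_transformation g" "f \<noteq> g"
  shows "finite {p. f p = g p}"
proof (rule ccontr)
  assume "infinite {p. f p = g p}"
  then obtain X where "X \<subseteq> {p. f p = g p}" "card X = 3"
    using infinite_arbitrarily_large by blast
  then obtain p q r where "p \<noteq> q" "q \<noteq> r" "p \<noteq> r" "f p = g p" "f q = g q" "f r = g r"
    by (auto simp: card_3_iff)
  then show False
    using moebius_transformation_eqI assms by blast
qed

section \<open>Stabilizers in the moduli group as groups of Moebius transformations\<close>

lemma inj_on_zpt:
  assumes "l \<in> Kn n" shows "inj_on (zpt l) {1..n}"
proof (rule inj_onI)
  fix i j assume ij: "i \<in> {1..n}" "j \<in> {1..n}" "zpt l i = zpt l j"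
  have l: "l i \<noteq> 0" "l i \<noteq> 1" if "i \<in> {1..n - 3}" for i
    using assms that by (auto simp: Kn_def PiE_iff)
  have inj: "i = j" if "i \<in> {1..n - 3}" "j \<in> {1..n - 3}" "l i = l j" for i j
    using assms that by (auto simp: Kn_def dest: inj_onD)
  have s: "i - 3 \<in> {1..n - 3}" if "i \<noteq> 1" "i \<noteq> 2" "i \<noteq> 3" "i \<in> {1..n}" for i
    using that by auto
  show "i = j"
    using ij l[OF s, of i] l[OF s, of j] inj[OF s s, of i j] by (auto simp: zpt_def split: if_splits)
qed

lemma zpt_image:
  assumes "3 \<le> n" shows "zpt l ` {1..n} = marking n l"
proof -
  have "{1..n} = {1, 2, 3} \<union> (\<lambda>i. i + 3) ` {1..n - 3}"
    using assms by (auto simp: image_iff)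
  moreover have "zpt l ` (\<lambda>i. i + 3) ` {1..n - 3} = (\<lambda>i. Some (l i)) ` {1..n - 3}"
    unfolding image_image by (rule image_cong) (auto simp: zpt_def)
  moreover have "zpt l ` {1, 2, 3} = {Some 0, Some 1, None}"
    by (auto simp: zpt_def)
  ultimately show ?thesis
    by (simp only: marking_def image_Un)
qed

lemma card_marking:
  assumes "3 \<le> n" "l \<in> Kn n" shows "card (marking n l) = n" "finite (marking n l)"
  using card_image[OF inj_on_zpt[OF assms(2)]] by (simp_all add: zpt_image[OF assms(1), symmetric])

text \<open>
  Send the first three points to 0, 1 and infinity; injectivity keeps the images of the
  others finite, distinct, and away from 0 and 1. From this normal form follow the
  well-definedness of \<open>g_perm\<close>, the faithfulness of the action of the symmetric group, and
  the passage from an arbitrary marked set to a marking.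
\<close>

lemma moebius_normal_form:
  assumes n: "3 \<le> n" and w: "inj_on w {1..n}"
  obtains T m where "moebius_transformation T" "m \<in> Kn n" "\<And>j. j \<in> {1..n} \<Longrightarrow> T (w j) = zpt m j"
proof -
  have w_eq: "w i = w j \<longleftrightarrow> i = j" if "i \<in> {1..n}" "j \<in> {1..n}" for i j
    using w that by (auto dest: inj_onD)
  have "w 1 \<noteq> w 2" "w 2 \<noteq> w 3" "w 1 \<noteq> w 3"
    using n by (auto simp: w_eq)
  then obtain T where T: "moebius_transformation T" "T (w 1) = Some 0" "T (w 2) = Some 1" "T (w 3) = None"
    using moebius_transformation_to_0_1_infinity by metis
  have T_eq: "T (w i) = T (w j) \<longleftrightarrow> i = j" if "i \<in> {1..n}" "j \<in> {1..n}" for i j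
    using w_eq[OF that] moebius_transformation_inj_iff[OF T(1)] by simp
  define m where "m = (\<lambda>i\<in>{1..n - 3}. the (T (w (i + 3))))"
  have m: "T (w (i + 3)) = Some (m i)" if "i \<in> {1..n - 3}" for i
  proof -
    have "T (w (i + 3)) \<noteq> None"
      using T_eq[of "i + 3" 3] that n T(4) by auto
    then show ?thesis using that by (auto simp: m_def)
  qed
  show thesis
  proof (rule that[OF T(1)])
    show "m \<in> Kn n"
      unfolding Kn_def mem_Collect_eq
    proof (intro conjI)
      show "m \<in> {1..n - 3} \<rightarrow>\<^sub>E - {0, 1}"
      proof (rule PiE_I)
        fix i assume i: "i \<in> {1..n - 3}"
        then have "i + 3 \<in> {1..n}" by auto
        then have "T (w (i + 3)) \<noteq> T (w 1)" "T (w (i + 3)) \<noteq> T (w 2)"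
          using T_eq[of "i + 3" 1] T_eq[of "i + 3" 2] i n by simp_all
        then show "m i \<in> - {0, 1}"
          using m[OF i] T by auto
      qed (auto simp: m_def)
      show "inj_on m {1..n - 3}"
      proof (rule inj_onI)
        fix i j assume ij: "i \<in> {1..n - 3}" "j \<in> {1..n - 3}" "m i = m j"
        then have "T (w (i + 3)) = T (w (j + 3))" by (simp add: m)
        then show "i = j" using T_eq[of "i + 3" "j + 3"] ij n by auto
      qed
    qed
    show "T (w j) = zpt m j" if "j \<in> {1..n}" for j
    proof (cases "j = 1 \<or> j = 2 \<or> j = 3")
      case False
      then have "j - 3 \<in> {1..n - 3}" "j - 3 + 3 = j" using that by auto
      then show ?thesis using m[of "j - 3"] False by (simp add: zpt_def)
    qed (use T(2-4) in \<open>auto simp: zpt_def\<close>)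
  qed
qed

lemma f_perm_eqI:
  assumes f: "moebius_transformation f" "f (zpt l (inv_into UNIV \<sigma> 1)) = Some 0"
      "f (zpt l (inv_into UNIV \<sigma> 2)) = Some 1" "f (zpt l (inv_into UNIV \<sigma> 3)) = None"
  shows "f_perm \<sigma> l = f"
  unfolding f_perm_def
proof (rule the_equality)
  fix g assume g: "moebius_transformation g \<and> g (zpt l (inv_into UNIV \<sigma> 1)) = Some 0 \<and>
     g (zpt l (inv_into UNIV \<sigma> 2)) = Some 1 \<and> g (zpt l (inv_into UNIV \<sigma> 3)) = None"
  show "g = f"
  proof (rule moebius_transformation_eqI)
    show "zpt l (inv_into UNIV \<sigma> 1) \<noteq> zpt l (inv_into UNIV \<sigma> 2)" 
      "zpt l (inv_into UNIV \<sigma> 2) \<noteq> zpt l (inv_into UNIV \<sigma> 3)"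
      "zpt l (inv_into UNIV \<sigma> 1) \<noteq> zpt l (inv_into UNIV \<sigma> 3)"
      using f(2-4) by auto
  qed (use f g in auto)
qed (use f in auto)

lemma f_perm_g_perm_eqI:
  assumes n: "3 \<le> n" and l: "l \<in> Kn n" and m: "m \<in> Kn n"
    and f: "moebius_transformation f"
    and fz: "\<And>j. j \<in> {1..n} \<Longrightarrow> f (zpt l (inv_into UNIV \<sigma> j)) = zpt m j"
  shows "f_perm \<sigma> l = f" "g_perm n \<sigma> l = m"
proof -
  show *: "f_perm \<sigma> l = f"
    using fz[of 1] fz[of 2] fz[of 3] n by (intro f_perm_eqI[OF f]) (auto simp: zpt_def)
  show "g_perm n \<sigma> l = m"
  proof
    fix i
    show "g_perm n \<sigma> l i = m i"
    proof (cases "i \<in> {1..n - 3}")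
      case True
      then show ?thesis
        using l fz[of "i + 3"] by (auto simp: g_perm_def * zpt_def)
    next
      case False
      then show ?thesis
        using l m by (auto simp: g_perm_def Kn_def PiE_iff extensional_def)
    qed
  qed
qed

text \<open>
  The transformation and the new parameter both exist because the permuted tuple has a
  normal form. Indexing by the source point \<open>i\<close> rather than by \<open>\<sigma> i\<close> keeps inverse
  permutations out of what follows.
\<close>

lemma f_perm_g_perm:
  assumes n: "3 \<le> n" and l: "l \<in> Kn n" and \<sigma>: "\<sigma> permutes {1..n}"
  shows moebius_transformation_f_perm: "moebius_transformation (f_perm \<sigma> l)"
    and g_perm_in_Kn: "g_perm n \<sigma> l \<in> Kn n"
    and f_perm_zpt: "\<And>i. i \<in> {1..n} \<Longrightarrow> f_perm \<sigma> l (zpt l i) = zpt (g_perm n \<sigma> l) (\<sigma> i)"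
proof -
  have "inv_into UNIV \<sigma> permutes {1..n}"
    using \<sigma> by (rule permutes_inv)
  then have "inj_on (\<lambda>j. zpt l (inv_into UNIV \<sigma> j)) {1..n}"
    using comp_inj_on[of "inv_into UNIV \<sigma>" "{1..n}" "zpt l"] inj_on_zpt[OF l]
    by (simp only: o_def permutes_image permutes_inj_on)
  then obtain T m where T: "moebius_transformation T" "m \<in> Kn n"
      "\<And>j. j \<in> {1..n} \<Longrightarrow> T (zpt l (inv_into UNIV \<sigma> j)) = zpt m j"
    using moebius_normal_form[OF n] by metis
  note * = f_perm_g_perm_eqI[OF n l T(2) T(1) T(3)]
  show "moebius_transformation (f_perm \<sigma> l)" "g_perm n \<sigma> l \<in> Kn n" using * T by auto
  fix i assume "i \<in> {1..n}"
  then have "\<sigma> i \<in> {1..n}" by (simp only: permutes_in_image[OF \<sigma>])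
  then show "f_perm \<sigma> l (zpt l i) = zpt (g_perm n \<sigma> l) (\<sigma> i)"
    using T(3)[of "\<sigma> i"] * by (simp add: permutes_inverses[OF \<sigma>])
qed

lemma g_perm_eqI:
  assumes n: "3 \<le> n" and l: "l \<in> Kn n" and m: "m \<in> Kn n" and \<sigma>: "\<sigma> permutes {1..n}"
    and f: "moebius_transformation f"
    and fz: "\<And>i. i \<in> {1..n} \<Longrightarrow> f (zpt l i) = zpt m (\<sigma> i)"
  shows "g_perm n \<sigma> l = m"
proof (rule f_perm_g_perm_eqI(2)[OF n l m f])
  fix j assume "j \<in> {1..n}"
  then show "f (zpt l (inv_into UNIV \<sigma> j)) = zpt m j"
    using fz[of "inv_into UNIV \<sigma> j"] permutes_in_image[OF permutes_inv[OF \<sigma>], of j]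
    by (simp add: permutes_inverses[OF \<sigma>])
qed

lemma g_perm_comp:
  assumes n: "3 \<le> n" and \<sigma>: "\<sigma> permutes {1..n}" and \<tau>: "\<tau> permutes {1..n}"
  shows "g_perm n (\<sigma> \<circ> \<tau>) = compose (Kn n) (g_perm n \<sigma>) (g_perm n \<tau>)"
proof
  fix l
  show "g_perm n (\<sigma> \<circ> \<tau>) l = compose (Kn n) (g_perm n \<sigma>) (g_perm n \<tau>) l"
  proof (cases "l \<in> Kn n")
    case l: True
    note T = f_perm_g_perm[OF n l \<tau>]
    note S = f_perm_g_perm[OF n T(2) \<sigma>]
    have "g_perm n (\<sigma> \<circ> \<tau>) l = g_perm n \<sigma> (g_perm n \<tau> l)"
    proof (rule g_perm_eqI[OF n l S(2) permutes_compose[OF \<tau> \<sigma>] moebius_transformation_comp[OF S(1) T(1)]])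
      fix i assume i: "i \<in> {1..n}"
      then have "\<tau> i \<in> {1..n}" by (simp only: permutes_in_image[OF \<tau>])
      then show "(f_perm \<sigma> (g_perm n \<tau> l) \<circ> f_perm \<tau> l) (zpt l i) =
          zpt (g_perm n \<sigma> (g_perm n \<tau> l)) ((\<sigma> \<circ> \<tau>) i)"
        using S(3) T(3)[OF i] by simp
    qed
    then show ?thesis using l by (simp add: compose_def)
  qed (simp add: g_perm_def compose_def)
qed

lemma g_perm_id: "3 \<le> n \<Longrightarrow> l \<in> Kn n \<Longrightarrow> g_perm n id l = l"
  by (rule g_perm_eqI[OF _ _ _ permutes_id moebius_transformation_id]) simp_all

text \<open>
  If \<open>g_perm n \<sigma>\<close> is trivial, then, by passing to normal forms, every injective tuple
  \<open>w\<close> of points admits a Moebius transformation that carries \<open>w i\<close> to \<open>w (\<sigma> i)\<close> for all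
  indices. Suppose that \<open>\<sigma>\<close> moves \<open>a\<close> to \<open>b \<noteq> a\<close>, and change only the point \<open>w b\<close>. The two
  resulting transformations agree at \<open>w i\<close> for all \<open>i\<close> other than \<open>a\<close> and \<open>b\<close>, but differ at
  \<open>w a\<close>. As \<open>n \<ge> 5\<close> leaves three points of agreement, this is impossible. (For \<open>n = 4\<close> the
  Klein four-group acts trivially, since it preserves every cross-ratio.)
\<close>

lemma g_perm_trivial_imp_id:
  assumes n: "5 \<le> n" and \<sigma>: "\<sigma> permutes {1..n}"
    and triv: "\<And>l. l \<in> Kn n \<Longrightarrow> g_perm n \<sigma> l = l"
  shows "\<sigma> = id"
proof (rule ccontr)
  assume "\<sigma> \<noteq> id"
  then obtain a where a: "\<sigma> a \<noteq> a" by (auto simp: fun_eq_iff)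
  define b where "b = \<sigma> a"
  have a_in: "a \<in> {1..n}" using a \<sigma> by (meson permutes_not_in)
  have b_in: "b \<in> {1..n}" using a_in unfolding b_def by (simp only: permutes_in_image[OF \<sigma>])
  have n3: "3 \<le> n" using n by simp
  have realise: "\<exists>f. moebius_transformation f \<and> (\<forall>i\<in>{1..n}. f (w i) = w (\<sigma> i))"
    if w: "inj_on w {1..n}" for w
  proof -
    obtain T m where T: "moebius_transformation T" "m \<in> Kn n" "\<And>j. j \<in> {1..n} \<Longrightarrow> T (w j) = zpt m j"
      using moebius_normal_form[OF n3 w] by metis
    obtain S where S: "moebius_transformation S" "T \<circ> S = id" "S \<circ> T = id"
      using moebius_transformation_inverse[OF T(1)] by metis
    have ST: "S (T p) = p" for p using S(3) by (metis comp_apply id_apply)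
    note F = f_perm_g_perm[OF n3 T(2) \<sigma>]
    have "(S \<circ> f_perm \<sigma> m \<circ> T) (w i) = w (\<sigma> i)" if "i \<in> {1..n}" for i
    proof -
      have "\<sigma> i \<in> {1..n}" using that by (simp only: permutes_in_image[OF \<sigma>])
      then show ?thesis
        using T(3)[of i] T(3)[of "\<sigma> i"] F(3)[of i] that triv[OF T(2)] ST[of "w (\<sigma> i)"] by simp
    qed
    moreover have "moebius_transformation (S \<circ> f_perm \<sigma> m \<circ> T)"
      by (intro moebius_transformation_comp S T F)
    ultimately show ?thesis by blast
  qed
  define w where "w i = Some (of_nat i :: complex)" for i
  define w' where "w' = w(b := None)"
  have "inj_on w {1..n}" "inj_on w' {1..n}"
    by (auto simp: inj_on_def w_def w'_def)
  note realise[OF this(1)] realise[OF this(2)]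
  then obtain f f' where f: "moebius_transformation f" "\<And>i. i \<in> {1..n} \<Longrightarrow> f (w i) = w (\<sigma> i)"
    and f': "moebius_transformation f'" "\<And>i. i \<in> {1..n} \<Longrightarrow> f' (w' i) = w' (\<sigma> i)"
    by blast
  have agree: "f (w i) = f' (w i)" if "i \<in> {1..n} - {a, b}" for i
  proof -
    have "\<sigma> i \<noteq> b" using that permutes_inj[OF \<sigma>] by (auto simp: b_def inj_eq)
    then show ?thesis using f(2)[of i] f'(2)[of i] that by (simp add: w'_def)
  qed
  have "card ({1..n} - {a, b}) \<ge> 3"
    using n diff_card_le_card_Diff[of "{a, b}" "{1..n}"] card_insert_le_m1[of 2 "{b}" a] by simp
  then obtain X where X: "X \<subseteq> {1..n} - {a, b}" "card X = 3"
    by (rule obtain_subset_with_card_n)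
  then obtain i j k where ijk: "X = {i, j, k}" "i \<noteq> j" "j \<noteq> k" "i \<noteq> k"
    by (auto simp: card_3_iff)
  have "f = f'"
    using ijk X(1) f(1) f'(1)
    by (intro moebius_transformation_eqI[of _ _ "w i" "w j" "w k"] agree) (auto simp: w_def)
  moreover have "f (w a) = Some (of_nat b)" "f' (w a) = None"
    using f(2)[OF a_in] f'(2)[OF a_in] a by (auto simp: b_def w_def w'_def)
  ultimately show False by simp
qed

lemma g_perm_inject:
  assumes n: "5 \<le> n" and \<sigma>: "\<sigma> permutes {1..n}" and \<tau>: "\<tau> permutes {1..n}"
    and eq: "g_perm n \<sigma> = g_perm n \<tau>"
  shows "\<sigma> = \<tau>"
proof -
  let ?i = "inv_into UNIV \<tau>"
  have n3: "3 \<le> n" using n by simp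
  have i: "?i permutes {1..n}" by (rule permutes_inv[OF \<tau>])
  have "?i \<circ> \<sigma> = id"
  proof (rule g_perm_trivial_imp_id[OF n permutes_compose[OF \<sigma> i]])
    fix l assume l: "l \<in> Kn n"
    have "g_perm n (?i \<circ> \<sigma>) = g_perm n (?i \<circ> \<tau>)"
      unfolding g_perm_comp[OF n3 i \<sigma>] g_perm_comp[OF n3 i \<tau>] eq ..
    also have "?i \<circ> \<tau> = id" by (simp add: permutes_inv_o[OF \<tau>])
    finally show "g_perm n (?i \<circ> \<sigma>) l = l" using g_perm_id[OF n3 l] by (simp only:)
  qed
  then have "\<tau> \<circ> (?i \<circ> \<sigma>) = \<tau>" by simp
  then show ?thesis by (simp add: o_assoc permutes_inv_o[OF \<tau>])
qed

definition moebius_stabilizer :: "riemann_sphere set \<Rightarrow> (riemann_sphere \<Rightarrow> riemann_sphere) monoid" where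
  "moebius_stabilizer P =
     \<lparr>carrier = {f. moebius_transformation f \<and> f ` P = P}, mult = (\<circ>), one = id\<rparr>"

text \<open>
  The permutation that a transformation induces on the indices of the marked points; outside
  \<open>{1..n}\<close> it is the identity, as required by \<^term>\<open>f permutes S\<close>.
\<close>

definition marking_perm :: "nat \<Rightarrow> (nat \<Rightarrow> complex) \<Rightarrow> (riemann_sphere \<Rightarrow> riemann_sphere) \<Rightarrow> nat \<Rightarrow> nat" where
  "marking_perm n l f i =
     (if i \<in> {1..n} then inv_into {1..n} (zpt l) (f (zpt l i)) else i)"

lemma marking_perm:
  assumes n: "3 \<le> n" and l: "l \<in> Kn n"
    and f: "moebius_transformation f" "f ` marking n l = marking n l"
  shows zpt_marking_perm: "\<And>i. i \<in> {1..n} \<Longrightarrow> zpt l (marking_perm n l f i) = f (zpt l i)"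
    and marking_perm_permutes: "marking_perm n l f permutes {1..n}"
proof -
  have in_img: "f (zpt l i) \<in> zpt l ` {1..n}" if "i \<in> {1..n}" for i
    using f(2) that zpt_image[OF n, of l] by (metis imageI)
  show z: "zpt l (marking_perm n l f i) = f (zpt l i)" if "i \<in> {1..n}" for i
    using that f_inv_into_f[OF in_img[OF that]] by (simp only: marking_perm_def if_True)
  have mem: "marking_perm n l f i \<in> {1..n}" if "i \<in> {1..n}" for i
    unfolding marking_perm_def using that inv_into_into[OF in_img[OF that]] by simp
  have inj: "inj_on (marking_perm n l f) {1..n}"
  proof (rule inj_onI)
    fix i j assume "i \<in> {1..n}" "j \<in> {1..n}" "marking_perm n l f i = marking_perm n l f j"
    then show "i = j"
      using z[of i] z[of j] moebius_transformation_inj_iff[OF f(1)] inj_on_eq_iff[OF inj_on_zpt[OF l], of i j]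
      by simp
  qed
  have "marking_perm n l f ` {1..n} = {1..n}"
    using mem inj by (intro endo_inj_surj) auto
  then show "marking_perm n l f permutes {1..n}"
    using inj by (intro bij_imp_permutes) (auto simp: bij_betw_def marking_perm_def)
qed

lemma marking_perm_eqI:
  assumes l: "l \<in> Kn n" and \<sigma>: "\<sigma> permutes {1..n}"
    and f: "\<And>i. i \<in> {1..n} \<Longrightarrow> f (zpt l i) = zpt l (\<sigma> i)"
  shows "marking_perm n l f = \<sigma>"
proof
  fix i
  show "marking_perm n l f i = \<sigma> i"
  proof (cases "i \<in> {1..n}")
    case True
    then have "\<sigma> i \<in> {1..n}" by (simp only: permutes_in_image[OF \<sigma>])
    then show ?thesis
      using True f[OF True] inv_into_f_f[OF inj_on_zpt[OF l]] by (simp add: marking_perm_def)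
  qed (auto simp: marking_perm_def permutes_not_in[OF \<sigma>])
qed

text \<open>
  A transformation
  \<open>f\<close> that preserves the marking permutes the marked points by some \<open>\<sigma>\<close>, and then
  \<open>f\<close> is the normalizing map \<open>f_perm \<sigma> l\<close> and \<open>g_perm n \<sigma>\<close> fixes \<open>l\<close>; conversely, an element
  \<open>g_perm n \<sigma>\<close> that fixes \<open>l\<close> comes from \<open>f_perm \<sigma> l\<close>. Injectivity needs that \<open>\<sigma>\<close> can
  be recovered from \<open>g_perm n \<sigma>\<close>, which is where \<open>n \<ge> 5\<close> enters.
\<close>

theorem moebius_stabilizer_iso_stab:
  assumes n: "5 \<le> n" and l: "l \<in> Kn n"
  shows "moebius_stabilizer (marking n l) \<cong> stab n l"
proof -
  have n3: "3 \<le> n" using n by simp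
  let ?M = "carrier (moebius_stabilizer (marking n l))"
  let ?h = "\<lambda>f. g_perm n (marking_perm n l f)"
  have M: "moebius_transformation f" "f ` marking n l = marking n l" if "f \<in> ?M" for f
    using that by (auto simp: moebius_stabilizer_def)
  note z = zpt_marking_perm[OF n3 l M] and p = marking_perm_permutes[OF n3 l M]
  have h_fixes: "?h f l = l" if f: "f \<in> ?M" for f
    using z[OF f f] by (intro g_perm_eqI[OF n3 l l p[OF f f] M(1)[OF f]]) simp
  have comp: "marking_perm n l (f \<circ> g) = marking_perm n l f \<circ> marking_perm n l g"
    if f: "f \<in> ?M" and g: "g \<in> ?M" for f g
  proof (rule marking_perm_eqI[OF l permutes_compose[OF p[OF g g] p[OF f f]]])
    fix i assume i: "i \<in> {1..n}"
    then have "marking_perm n l g i \<in> {1..n}" by (simp only: permutes_in_image[OF p[OF g g]])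
    then show "(f \<circ> g) (zpt l i) = zpt l ((marking_perm n l f \<circ> marking_perm n l g) i)"
      using z[OF f f] z[OF g g i] by simp
  qed
  have "?h \<in> iso (moebius_stabilizer (marking n l)) (stab n l)"
  proof (rule isoI)
    show "?h \<in> hom (moebius_stabilizer (marking n l)) (stab n l)"
    proof (rule homI)
      fix f assume f: "f \<in> ?M"
      then show "?h f \<in> carrier (stab n l)"
        using h_fixes[OF f] p[OF f f] by (auto simp: stab_def Gn_def)
      fix g assume g: "g \<in> ?M"
      show "?h (f \<otimes>\<^bsub>moebius_stabilizer (marking n l)\<^esub> g) = ?h f \<otimes>\<^bsub>stab n l\<^esub> ?h g"
        using comp[OF f g] g_perm_comp[OF n3 p[OF f f] p[OF g g]]
        by (simp add: moebius_stabilizer_def stab_def Gn_def)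
    qed
    show "bij_betw ?h ?M (carrier (stab n l))"
      unfolding bij_betw_def
    proof
      show "inj_on ?h ?M"
      proof (rule inj_onI)
        fix f g assume f: "f \<in> ?M" and g: "g \<in> ?M" and "?h f = ?h g"
        then have eq: "marking_perm n l f = marking_perm n l g"
          using g_perm_inject[OF n p[OF f f] p[OF g g]] by simp
        have "f (zpt l i) = g (zpt l i)" if "i \<in> {1..n}" for i
          using z[OF f f that] z[OF g g that] eq by simp
        moreover have "zpt l i \<noteq> zpt l j" if "i \<in> {1..n}" "j \<in> {1..n}" "i \<noteq> j" for i j
          using inj_on_eq_iff[OF inj_on_zpt[OF l]] that by blast
        ultimately show "f = g"
          using n by (intro moebius_transformation_eqI[OF M(1)[OF f] M(1)[OF g], of "zpt l 1" "zpt l 2" "zpt l 3"]) auto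
      qed
      show "?h ` ?M = carrier (stab n l)"
      proof
        show "?h ` ?M \<subseteq> carrier (stab n l)"
          using h_fixes p by (auto simp: stab_def Gn_def)
        show "carrier (stab n l) \<subseteq> ?h ` ?M"
        proof
          fix g assume "g \<in> carrier (stab n l)"
          then obtain \<sigma> where \<sigma>: "\<sigma> permutes {1..n}" and g: "g = g_perm n \<sigma>" "g_perm n \<sigma> l = l"
            by (auto simp: stab_def Gn_def)
          let ?f = "f_perm \<sigma> l"
          have fz: "?f (zpt l i) = zpt l (\<sigma> i)" if "i \<in> {1..n}" for i
            using f_perm_zpt[OF n3 l \<sigma> that] g by simp
          have "?f ` marking n l = (\<lambda>i. zpt l (\<sigma> i)) ` {1..n}"
            unfolding zpt_image[OF n3, symmetric] image_image using fz by (rule image_cong[OF refl])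
          also have "\<dots> = marking n l"
            unfolding image_image[symmetric, of "zpt l" \<sigma>] permutes_image[OF \<sigma>] by (rule zpt_image[OF n3])
          finally have "?f \<in> ?M"
            using moebius_transformation_f_perm[OF n3 l \<sigma>] by (simp add: moebius_stabilizer_def)
          moreover have "?h ?f = g"
            using marking_perm_eqI[OF l \<sigma> fz] g by simp
          ultimately show "g \<in> ?h ` ?M" by blast
        qed
      qed
    qed
  qed
  then show ?thesis unfolding is_iso_def by blast
qed

section \<open>The action of PSL(2,C) on the sphere\<close>

definition matrix_moebius :: "complex^2^2 \<Rightarrow> riemann_sphere \<Rightarrow> riemann_sphere" where
  "matrix_moebius A = moebius_sphere (A $ 1 $ 1) (A $ 1 $ 2) (A $ 2 $ 1) (A $ 2 $ 2)"

lemma moebius_transformation_matrix_moebius: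
  "det A \<noteq> 0 \<Longrightarrow> moebius_transformation (matrix_moebius A)"
  unfolding moebius_transformation_def matrix_moebius_def det_2 by blast

lemma matrix_moebius_mult:
  "det B \<noteq> 0 \<Longrightarrow> matrix_moebius (A ** B) = matrix_moebius A \<circ> matrix_moebius B"
  by (simp add: matrix_moebius_def det_2 moebius_sphere_comp matrix_matrix_mult_def sum_2)

lemma matrix_moebius_one: "matrix_moebius (mat 1) = id"
  by (simp add: matrix_moebius_def mat_def moebius_sphere_scalar)

lemma hpt_uminus: "hpt (- u) (- v) = hpt u v"
  by (simp add: hpt_def)

lemma matrix_moebius_uminus: "matrix_moebius (- A) = matrix_moebius A"
proof
  fix p
  obtain u v where p: "p = hpt u v" "u \<noteq> 0 \<or> v \<noteq> 0" by (rule hpt_cases)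
  show "matrix_moebius (- A) p = matrix_moebius A p"
    unfolding matrix_moebius_def p(1) moebius_sphere_hpt[OF p(2)]
    using hpt_uminus[of "A $ 1 $ 1 * u + A $ 1 $ 2 * v" "A $ 2 $ 1 * u + A $ 2 $ 2 * v"]
    by simp
qed

lemma uminus_mat_1_mult: "- mat 1 ** A = - A" "A ** - mat 1 = - A" for A :: "complex^2^2"
  by (simp_all add: vec_eq_iff forall_2 matrix_matrix_mult_def mat_def sum_2)

lemma uminus_matrix_mult: "- A ** B = - (A ** B)" "A ** - B = - (A ** B)" for A B :: "complex^2^2"
  by (simp_all add: vec_eq_iff forall_2 matrix_matrix_mult_def sum_2)

lemma det_uminus_2: "det (- A) = det A" for A :: "complex^2^2"
  by (simp add: det_2)

text \<open>
  Fixing infinity, 0 and 1 forces a scalar matrix, and the determinant leaves only two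
  scalars. This is the kernel of the action of \<^term>\<open>SL2C\<close>.
\<close>

lemma matrix_moebius_eq_id:
  assumes "det A = 1" "matrix_moebius A = id"
  shows "A = mat 1 \<or> A = - mat 1"
proof -
  have "A $ 2 $ 1 = 0" "A $ 1 $ 2 = 0" "A $ 1 $ 1 = A $ 2 $ 2"
    using fun_cong[OF assms(2), of None] fun_cong[OF assms(2), of "Some 0"]
      fun_cong[OF assms(2), of "Some 1"]
    by (auto simp: matrix_moebius_def moebius_sphere_def moebius_def split: if_splits)
  moreover from this have "A $ 2 $ 2 = 1 \<or> A $ 2 $ 2 = - 1"
    using assms(1) by (simp add: det_2 square_eq_1_iff)
  ultimately show ?thesis
    by (auto simp: vec_eq_iff forall_2 mat_def)
qed

lemma SL2C_simps:
  "carrier SL2C = {A. det A = 1}" "A \<otimes>\<^bsub>SL2C\<^esub> B = A ** B" "\<one>\<^bsub>SL2C\<^esub> = mat 1"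
  by (simp_all add: SL2C_def)

lemma group_SL2C: "group SL2C"
proof (rule groupI)
  fix A assume "A \<in> carrier SL2C"
  then have A: "det A = 1" by (simp add: SL2C_simps)
  then obtain B where B: "B ** A = mat 1"
    by (metis invertible_det_nz invertible_left_inverse zero_neq_one)
  then have "det B * det A = 1" by (metis det_mul det_I)
  then show "\<exists>B\<in>carrier SL2C. B \<otimes>\<^bsub>SL2C\<^esub> A = \<one>\<^bsub>SL2C\<^esub>"
    using A B by (auto simp: SL2C_simps)
qed (auto simp: SL2C_simps det_mul matrix_mul_assoc)

lemma r_coset_SL2C: "{mat 1, - mat 1} #>\<^bsub>SL2C\<^esub> A = {A, - A}"
  by (auto simp: r_coset_def SL2C_simps uminus_mat_1_mult)

lemma group_PSL2C: "group PSL2C"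
proof -
  interpret SL: group SL2C by (rule group_SL2C)
  have "subgroup {mat 1, - mat 1} SL2C"
  proof (rule SL.subgroupI)
    fix A :: "complex^2^2" assume A: "A \<in> {mat 1, - mat 1}"
    then have "inv\<^bsub>SL2C\<^esub> A = A"
      by (intro SL.inv_equality) (auto simp: SL2C_simps uminus_mat_1_mult det_uminus_2)
    then show "inv\<^bsub>SL2C\<^esub> A \<in> {mat 1, - mat 1}" using A by simp
  qed (auto simp: SL2C_simps uminus_mat_1_mult det_uminus_2)
  then have "{mat 1, - mat 1} \<lhd> SL2C"
    unfolding normal_def normal_axioms_def
    by (auto simp: r_coset_SL2C group_SL2C l_coset_def SL2C_simps uminus_mat_1_mult)
  then show ?thesis
    unfolding PSL2C_def by (rule normal.factorgroup_is_group)
qed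

lemma PSL2C_cases:
  assumes "C \<in> carrier PSL2C"
  obtains A where "det A = 1" "C = {A, - A}"
  using assms by (auto simp: PSL2C_def carrier_FactGroup r_coset_SL2C SL2C_simps)

lemma PSL2C_mult: "{A, - A} \<otimes>\<^bsub>PSL2C\<^esub> {B, - B} = {A ** B, - (A ** B)}"
  by (auto simp: PSL2C_def set_mult_def SL2C_simps uminus_matrix_mult)

lemma PSL2C_one: "\<one>\<^bsub>PSL2C\<^esub> = {mat 1, - mat 1}"
  by (simp add: PSL2C_def)

text \<open>
  The choice of representative is harmless: the elements of \<^term>\<open>PSL2C\<close> are the pairs
  \<open>{A, - A}\<close>, and both matrices act in the same way.
\<close>

definition psl_moebius :: "(complex^2^2) set \<Rightarrow> riemann_sphere \<Rightarrow> riemann_sphere" where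
  "psl_moebius C = matrix_moebius (SOME A. A \<in> C)"

lemma psl_moebius: "psl_moebius {A, - A} = matrix_moebius A"
  unfolding psl_moebius_def
  by (rule someI2[of "\<lambda>B. B \<in> {A, - A}" A]) (auto simp: matrix_moebius_uminus)

lemma moebius_transformation_psl_moebius:
  assumes "C \<in> carrier PSL2C" shows "moebius_transformation (psl_moebius C)"
  using PSL2C_cases[OF assms] moebius_transformation_matrix_moebius psl_moebius
  by (metis zero_neq_one)

lemma psl_moebius_mult:
  assumes "C \<in> carrier PSL2C" "D \<in> carrier PSL2C"
  shows "psl_moebius (C \<otimes>\<^bsub>PSL2C\<^esub> D) = psl_moebius C \<circ> psl_moebius D"
proof -
  obtain A B where "det A = 1" "C = {A, - A}" "det B = 1" "D = {B, - B}"
    using assms PSL2C_cases by metis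
  then show ?thesis
    by (simp add: PSL2C_mult psl_moebius matrix_moebius_mult)
qed

lemma inj_on_psl_moebius: "inj_on psl_moebius (carrier PSL2C)"
proof (rule inj_onI)
  fix C D assume "C \<in> carrier PSL2C" "D \<in> carrier PSL2C" and eq: "psl_moebius C = psl_moebius D"
  then obtain A B where A: "det A = 1" "C = {A, - A}" and B: "det B = 1" "D = {B, - B}"
    using PSL2C_cases by metis
  obtain B' where B': "B' ** B = mat 1" "B ** B' = mat 1"
    using B(1) by (metis invertible_det_nz invertible_def zero_neq_one)
  then have "det B' = 1" using B(1) by (metis det_mul det_I mult.right_neutral)
  then have "det (B' ** A) = 1" using A by (simp add: det_mul)
  moreover have "matrix_moebius (B' ** A) = id"
    using eq A B B'(1) matrix_moebius_mult[of A B'] matrix_moebius_mult[of B B']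
    by (simp add: psl_moebius matrix_moebius_one)
  ultimately have "B' ** A = mat 1 \<or> B' ** A = - mat 1"
    by (rule matrix_moebius_eq_id)
  then have "B ** (B' ** A) = B \<or> B ** (B' ** A) = - B"
    by (auto simp: uminus_mat_1_mult)
  then show "C = D"
    using A B B'(2) by (auto simp: matrix_mul_assoc)
qed

section \<open>Point sets with prescribed stabilizer\<close>

text \<open>
  Start with a finite invariant set \<open>Q\<close> that has at least three points more than \<open>S\<close> has
  elements, and add the orbit of one further point \<open>x\<close>. That orbit has at most \<open>card S\<close> points,
  so a transformation \<open>h\<close> that preserves the union maps at least three points of \<open>Q\<close> into \<open>Q\<close>.
  This leaves only finitely many candidates \<open>h\<close>, collected in \<open>H\<close> independently of \<open>x\<close>. A
  point \<open>x\<close> outside a finite set then satisfies \<open>h x \<notin> Q\<close> for all \<open>h\<close> in \<open>H\<close>, and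
  \<open>h x \<noteq> g x\<close> for all \<open>h\<close> in \<open>H\<close> and \<open>g\<close> in \<open>S\<close> with \<open>g \<noteq> h\<close>. For such an \<open>x\<close>, a
  symmetry \<open>h\<close> must send \<open>x\<close> to some \<open>g x\<close>, whence \<open>h = g\<close>. The elements of \<open>S\<close> map the union into itself, hence
  onto itself, because it is finite.
\<close>

lemma exists_set_with_stabilizer:
  assumes fin: "finite S" and S: "\<And>f. f \<in> S \<Longrightarrow> moebius_transformation f"
    and id: "id \<in> S" and comp: "\<And>f g. f \<in> S \<Longrightarrow> g \<in> S \<Longrightarrow> f \<circ> g \<in> S"
  obtains P where "finite P" "card S + 3 \<le> card P" "carrier (moebius_stabilizer P) = S"
proof -
  define orb where "orb X = (\<Union>f\<in>S. f ` X)" for X :: "riemann_sphere set"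
  have fin_orb: "finite (orb X)" if "finite X" for X
    using fin that by (auto simp: orb_def)
  have orb_sub: "X \<subseteq> orb X" for X
    using UN_upper[OF id, of "\<lambda>f. f ` X"] by (simp add: orb_def)
  have orb_closed: "f ` orb X \<subseteq> orb X" if "f \<in> S" for f X
  proof
    fix y assume "y \<in> f ` orb X"
    then obtain g x where "g \<in> S" "x \<in> X" "y = (f \<circ> g) x"
      by (auto simp: orb_def)
    then show "y \<in> orb X"
      using comp[OF that] unfolding orb_def by blast
  qed
  have inf: "infinite (UNIV :: riemann_sphere set)"
    by (simp add: infinite_UNIV_char_0)
  obtain X :: "riemann_sphere set" where X: "finite X" "card X = card S + 3"
    using infinite_arbitrarily_large[OF inf] by blast
  define Q where "Q = orb X"
  have Q: "finite Q" "card S + 3 \<le> card Q"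
    using fin_orb[OF X(1)] card_mono[OF fin_orb[OF X(1)] orb_sub] X(2) by (simp_all add: Q_def)
  define H where "H = {h. moebius_transformation h \<and>
     (\<exists>p\<in>Q. \<exists>q\<in>Q. \<exists>r\<in>Q. p \<noteq> q \<and> q \<noteq> r \<and> p \<noteq> r \<and> h p \<in> Q \<and> h q \<in> Q \<and> h r \<in> Q)}"
  have "finite H"
  proof -
    \<comment> \<open>Three values at three points leave at most one transformation, so \<open>K\<close> covers \<open>H\<close> by finitely many sets of size at most one.\<close>
    define K where "K = (\<lambda>(p, q, r, p', q', r'). {h. moebius_transformation h \<and>
       p \<noteq> q \<and> q \<noteq> r \<and> p \<noteq> r \<and> h p = p' \<and> h q = q' \<and> h r = r'})"
    have "finite (K t)" for t
    proof -
      obtain p q r p' q' r' where t: "t = (p, q, r, p', q', r')" by (metis surj_pair)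
      have eq: "f = g" if "f \<in> K t" "g \<in> K t" for f g
        using that moebius_transformation_eqI[of f g p q r] by (auto simp: K_def t)
      show ?thesis
      proof (cases "K t = {}")
        case False
        then obtain f where "f \<in> K t" by blast
        with eq have "K t \<subseteq> {f}" by blast
        then show ?thesis by (rule finite_subset) simp
      qed simp
    qed
    then have "finite (\<Union>t\<in>Q \<times> Q \<times> Q \<times> Q \<times> Q \<times> Q. K t)"
      using Q(1) by blast
    moreover have "H \<subseteq> (\<Union>t\<in>Q \<times> Q \<times> Q \<times> Q \<times> Q \<times> Q. K t)"
    proof
      fix h assume "h \<in> H"
      then obtain p q r where "p \<in> Q" "q \<in> Q" "r \<in> Q" "h p \<in> Q" "h q \<in> Q" "h r \<in> Q"
        "moebius_transformation h" "p \<noteq> q" "q \<noteq> r" "p \<noteq> r"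
        unfolding H_def by blast
      then show "h \<in> (\<Union>t\<in>Q \<times> Q \<times> Q \<times> Q \<times> Q \<times> Q. K t)"
        by (intro UN_I[of "(p, q, r, h p, h q, h r)"]) (auto simp: K_def)
    qed
    ultimately show ?thesis by (rule finite_subset[rotated])
  qed
  have H: "moebius_transformation h" if "h \<in> H" for h
    using that by (simp add: H_def)
  define bad where "bad = (\<Union>h\<in>H. h -` Q) \<union> (\<Union>h\<in>H. \<Union>g\<in>S - {h}. {x. h x = g x})"
  have "finite (h -` Q)" if "h \<in> H" for h
    using finite_vimageI[OF Q(1)] H[OF that] moebius_transformation_bij bij_is_inj by blast
  moreover have "finite {x. h x = g x}" if "h \<in> H" "g \<in> S - {h}" for h g
    using finite_moebius_coincidence[of h g] H S that by auto
  ultimately have "finite bad"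
    using \<open>finite H\<close> fin by (auto simp: bad_def)
  then obtain x where x: "x \<notin> bad"
    using inf ex_new_if_finite by blast
  define P where "P = Q \<union> orb {x}"
  have P: "finite P" using Q fin_orb by (simp add: P_def)
  have "carrier (moebius_stabilizer P) = S"
  proof
    show "S \<subseteq> carrier (moebius_stabilizer P)"
    proof
      fix f assume f: "f \<in> S"
      have "f ` P \<subseteq> P"
        using orb_closed[OF f] unfolding P_def Q_def by blast
      moreover have "inj_on f P"
        using moebius_transformation_bij[OF S[OF f]] by (meson bij_is_inj inj_on_subset subset_UNIV)
      ultimately have "f ` P = P" using P by (intro endo_inj_surj)
      then show "f \<in> carrier (moebius_stabilizer P)"
        using S[OF f] by (simp add: moebius_stabilizer_def)
    qed
    show "carrier (moebius_stabilizer P) \<subseteq> S"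
    proof
      fix h assume "h \<in> carrier (moebius_stabilizer P)"
      then have h: "moebius_transformation h" "h ` P = P" by (simp_all add: moebius_stabilizer_def)
      \<comment> \<open>The points of \<open>Q\<close> that leave \<open>Q\<close> are injected into the orbit of \<open>x\<close>.\<close>
      define R where "R = {q \<in> Q. h q \<notin> Q}"
      have "h ` R \<subseteq> orb {x}"
        using h(2) unfolding R_def P_def by blast
      then have "card R \<le> card (orb {x})"
        by (rule card_inj_on_le[rotated]) (use h(1) fin_orb in \<open>auto simp: inj_on_def moebius_transformation_inj_iff\<close>)
      also have "orb {x} = (\<lambda>f. f x) ` S" by (auto simp: orb_def)
      also have "card \<dots> \<le> card S" by (rule card_image_le[OF fin])
      finally have "card R \<le> card S" .
      then have "3 \<le> card (Q - R)"
        using Q card_Diff_subset[of R Q] finite_subset[of R Q] by (simp add: R_def)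
      then obtain Y where "Y \<subseteq> Q - R" "card Y = 3"
        by (rule obtain_subset_with_card_n)
      then obtain p q r where "p \<noteq> q" "q \<noteq> r" "p \<noteq> r" "{p, q, r} \<subseteq> Q - R"
        by (auto simp: card_3_iff)
      then have hH: "h \<in> H"
        using h(1) unfolding H_def R_def by blast
      have "x \<in> P" using orb_sub[of "{x}"] by (simp add: P_def)
      then have "h x \<in> P" using h(2) by blast
      moreover have "h x \<notin> Q" using x hH by (auto simp: bad_def)
      ultimately obtain g where "g \<in> S" "h x = g x" by (auto simp: P_def orb_def)
      then have "h = g" using x hH unfolding bad_def by blast
      then show "h \<in> S" using \<open>g \<in> S\<close> by simp
    qed
  qed
  moreover have "card S + 3 \<le> card P"
    using Q card_mono[OF P, of Q] by (auto simp: P_def)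
  ultimately show thesis using that P by blast
qed

lemma moebius_stabilizer_image_iso:
  assumes T: "moebius_transformation T"
  shows "moebius_stabilizer P \<cong> moebius_stabilizer (T ` P)"
proof -
  obtain U where U: "moebius_transformation U" "T \<circ> U = id" "U \<circ> T = id"
    using moebius_transformation_inverse[OF T] by metis
  have UT: "U (T x) = x" "T (U x) = x" for x
    using U(2,3) by (metis comp_apply id_apply)+
  have conj: "B \<circ> f \<circ> A \<in> carrier (moebius_stabilizer (B ` P))"
    if "moebius_transformation A" "moebius_transformation B" "\<And>x. A (B x) = x"
      "f \<in> carrier (moebius_stabilizer P)" for A B f P
  proof -
    have "(B \<circ> f \<circ> A) ` B ` P = B ` f ` P"
      using that(3) by (simp add: image_image)
    then show ?thesis
      using that by (auto simp: moebius_stabilizer_def intro!: moebius_transformation_comp)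
  qed
  have "(\<lambda>f. T \<circ> f \<circ> U) \<in> iso (moebius_stabilizer P) (moebius_stabilizer (T ` P))"
  proof (rule isoI)
    show "(\<lambda>f. T \<circ> f \<circ> U) \<in> hom (moebius_stabilizer P) (moebius_stabilizer (T ` P))"
      using conj[OF U(1) T UT(1)]
      by (intro homI) (auto simp: moebius_stabilizer_def fun_eq_iff UT)
    show "bij_betw (\<lambda>f. T \<circ> f \<circ> U) (carrier (moebius_stabilizer P)) (carrier (moebius_stabilizer (T ` P)))"
    proof (rule bij_betw_byWitness[where f' = "\<lambda>f. U \<circ> f \<circ> T"])
      show "(\<lambda>f. T \<circ> f \<circ> U) ` carrier (moebius_stabilizer P) \<subseteq> carrier (moebius_stabilizer (T ` P))"
        using conj[OF U(1) T UT(1)] by blast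
      have "U ` T ` P = P" by (simp add: image_image UT)
      then show "(\<lambda>f. U \<circ> f \<circ> T) ` carrier (moebius_stabilizer (T ` P)) \<subseteq> carrier (moebius_stabilizer P)"
        using conj[OF T U(1) UT(2), of _ "T ` P"] by auto
    qed (auto simp: fun_eq_iff UT)
  qed
  then show ?thesis unfolding is_iso_def by blast
qed

lemma moebius_equivalent_marking:
  assumes "finite P" "3 \<le> card P"
  obtains T l where "moebius_transformation T" "l \<in> Kn (card P)" "T ` P = marking (card P) l"
proof -
  obtain w where w: "bij_betw w {1..card P} P"
    using ex_bij_betw_nat_finite_1[OF assms(1)] by blast
  then obtain T l where T: "moebius_transformation T" "l \<in> Kn (card P)"
    "\<And>j. j \<in> {1..card P} \<Longrightarrow> T (w j) = zpt l j"
    using moebius_normal_form[OF assms(2), of w] bij_betw_imp_inj_on by metis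
  have "T ` P = (\<lambda>j. T (w j)) ` {1..card P}"
    using bij_betw_imp_surj_on[OF w] by (metis image_image)
  also have "\<dots> = zpt l ` {1..card P}"
    using T(3) by (rule image_cong[OF refl])
  finally show thesis
    using that T zpt_image[OF assms(2)] by simp
qed

lemma moduli_class_in_M0:
  assumes "3 \<le> n" "l \<in> Kn n" shows "moduli_class n l \<in> M0 n"
  unfolding moduli_class_def M0_def
  using quotientI[OF marked_sphere[OF card_marking(2)[OF assms]], of "marked_iso n"]
  by (simp add: card_marking(1)[OF assms])

section \<open>Finite subgroups of PSL(2,C) as stabilizers\<close>

theorem corollary16:
  fixes G :: "(complex^2^2) set set"
  assumes "subgroup G PSL2C" and "finite G" and "G \<noteq> {\<one>\<^bsub>PSL2C\<^esub>}"
  shows "\<exists>n\<ge>5. \<exists>x. orbifold_singularity n x \<and>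
           (\<exists>l\<in>Kn n. x = moduli_class n l \<and> stab n l \<cong> PSL2C\<lparr>carrier := G\<rparr>)"
proof -
  interpret G: subgroup G PSL2C by (rule assms(1))
  let ?G = "PSL2C\<lparr>carrier := G\<rparr>"
  have grp: "group ?G"
    using G.subgroup_is_group[OF group_PSL2C] .
  define S where "S = psl_moebius ` G"
  have inj: "inj_on psl_moebius G"
    using inj_on_psl_moebius G.subset by (rule inj_on_subset)
  obtain P where P: "finite P" "card S + 3 \<le> card P" "carrier (moebius_stabilizer P) = S"
  proof (rule exists_set_with_stabilizer[of S])
    show "finite S" using assms(2) by (simp add: S_def)
    show "moebius_transformation f" if "f \<in> S" for f
      using that G.subset moebius_transformation_psl_moebius by (auto simp: S_def)
    show "id \<in> S"
      unfolding S_def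
      by (rule image_eqI[OF _ G.one_closed]) (simp add: PSL2C_one psl_moebius matrix_moebius_one)
    show "f \<circ> g \<in> S" if fg: "f \<in> S" "g \<in> S" for f g
    proof -
      obtain C D where "C \<in> G" "f = psl_moebius C" "D \<in> G" "g = psl_moebius D"
        using fg by (auto simp: S_def)
      then show ?thesis
        using psl_moebius_mult[of C D] G.mem_carrier G.m_closed unfolding S_def by (metis imageI)
    qed
  qed
  have "psl_moebius \<in> iso ?G (moebius_stabilizer P)"
  proof (rule isoI)
    show "psl_moebius \<in> hom ?G (moebius_stabilizer P)"
    proof (rule homI)
      show "psl_moebius C \<in> carrier (moebius_stabilizer P)" if "C \<in> carrier ?G" for C
        using that by (simp add: P S_def)
      show "psl_moebius (C \<otimes>\<^bsub>?G\<^esub> D) = psl_moebius C \<otimes>\<^bsub>moebius_stabilizer P\<^esub> psl_moebius D"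
        if "C \<in> carrier ?G" "D \<in> carrier ?G" for C D
        using that by (simp add: psl_moebius_mult moebius_stabilizer_def)
    qed
    show "bij_betw psl_moebius (carrier ?G) (carrier (moebius_stabilizer P))"
      using inj by (simp add: bij_betw_def P S_def)
  qed
  then have "?G \<cong> moebius_stabilizer P" unfolding is_iso_def by blast
  \<comment> \<open>Together with the surplus of three points this yields at least five marked points.\<close>
  have card_G: "2 \<le> card G"
  proof -
    obtain C where "C \<in> G" "C \<noteq> \<one>\<^bsub>PSL2C\<^esub>" using assms(3) G.one_closed by blast
    then have "card {C, \<one>\<^bsub>PSL2C\<^esub>} \<le> card G"
      by (intro card_mono assms(2)) (auto simp: G.one_closed)
    then show ?thesis using \<open>C \<noteq> \<one>\<^bsub>PSL2C\<^esub>\<close> by simp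
  qed
  define n where "n = card P"
  have n: "5 \<le> n"
    using P(2) card_G card_image[OF inj] by (simp add: n_def S_def)
  then obtain T l where T: "moebius_transformation T" and l: "l \<in> Kn n" and TP: "T ` P = marking n l"
    using moebius_equivalent_marking[OF P(1)] unfolding n_def by auto
  note \<open>?G \<cong> moebius_stabilizer P\<close>
  also have "moebius_stabilizer P \<cong> moebius_stabilizer (marking n l)"
    using moebius_stabilizer_image_iso[OF T] TP by metis
  also have "moebius_stabilizer (marking n l) \<cong> stab n l"
    by (rule moebius_stabilizer_iso_stab[OF n l])
  finally have iso: "stab n l \<cong> ?G"
    by (rule group.iso_sym[OF grp])
  have "card (carrier (stab n l)) = card G"
    using iso_same_card[OF iso] by simp
  then have "carrier (stab n l) \<noteq> {\<one>\<^bsub>Gn n\<^esub>}"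
    using card_G by auto
  moreover have "moduli_class n l \<in> M0 n"
    using n by (intro moduli_class_in_M0 l) simp
  ultimately have "orbifold_singularity n (moduli_class n l)"
    using n l unfolding orbifold_singularity_def by blast
  then show ?thesis using n l iso by blast
qed

end
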